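(* Let $r\ge2$ and let $A_1,\ldots,A_r$ be positive semidefinite operators on a finite-dimensional Hilbert space. Then $$P_{e,2}^*(A_1,\ldots,A_r)\le\frac12P_{e,dich}^*(A_1,\ldots,A_r)\le P_e^*(A_1,\ldots,A_r)\le P_{e,dich}^*(A_1,\ldots,A_r).$$
   Context: A POVM $\{E_1,\ldots,E_m\}$ on a finite-dimensional Hilbert space is a family of positive semidefinite operators with $E_1+\cdots+E_m\le I$. For positive semidefinite $A_1,\ldots,A_m$, the optimal error is $P_e^*(A_1,\ldots,A_m):=\min\{\sum_{i=1}^m\operatorname{Tr}A_i(I-E_i):\{E_1,\ldots,E_m\}\text{ POVM}\}$; for two operators this equals $\frac12\operatorname{Tr}(A+B)-\frac12\|A-B\|_1$ with the trace norm. The pairwise error is $P_{e,2}^*(A_1,\ldots,A_r):=\frac1{r-1}\sum_{(k,l):\,k<l}P_e^*(A_k,A_l)$. With the complementary operators $\bar A_i:=\sum_{j\ne i}A_j$, the dichotomic error is $P_{e,dich}^*(A_1,\ldots,A_r):=\sum_{i=1}^rP_e^*(A_i,\bar A_i)$. *)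

theory Defs
  imports "HOL-Analysis.Analysis"
begin

text \<open>
  A finite-dimensional Hilbert space is $\mathbb{C}^n$, that is \<^typ>\<open>complex^'n\<close>, and operators
  are square matrices. Families $A_1,\dots,A_m$ are lists, so indices start at 0.
\<close>

definition cinner :: "complex^'n \<Rightarrow> complex^'n \<Rightarrow> complex" where
  "cinner v w = (\<Sum>i\<in>UNIV. cnj (v $ i) * w $ i)"

text \<open>Over the complex numbers a nonnegative quadratic form forces self-adjointness.\<close>

definition psd :: "complex^'n^'n \<Rightarrow> bool" where
  "psd A \<longleftrightarrow> (\<forall>v. cinner v (A *v v) \<in> \<real>\<^sub>\<ge>\<^sub>0)"

definition loewner_le :: "complex^'n^'n \<Rightarrow> complex^'n^'n \<Rightarrow> bool" where
  "loewner_le A B \<longleftrightarrow> psd (B - A)"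

text \<open>The operators of a POVM need not sum to the identity.\<close>

definition povm :: "(complex^'n^'n) list \<Rightarrow> bool" where
  "povm Es \<longleftrightarrow> (\<forall>E\<in>set Es. psd E) \<and> loewner_le (sum_list Es) (mat 1)"

text \<open>The traces are real when all operators involved are self-adjoint; \<^const>\<open>Re\<close> only
  changes the type.\<close>

definition povm_err :: "(complex^'n^'n) list \<Rightarrow> (complex^'n^'n) list \<Rightarrow> real" where
  "povm_err As Es = (\<Sum>i<length As. Re (trace (As ! i ** (mat 1 - Es ! i))))"

text \<open>The infimum is a minimum, see \<open>opt_err_attained\<close> below.\<close>

definition opt_err :: "(complex^'n^'n) list \<Rightarrow> real" where
  "opt_err As = Inf {povm_err As Es | Es. length Es = length As \<and> povm Es}"

definition pair_err :: "(complex^'n^'n) list \<Rightarrow> real" where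
  "pair_err As = 1 / (real (length As) - 1) *
     (\<Sum>(k, l) \<in> {(k, l). k < l \<and> l < length As}. opt_err [As ! k, As ! l])"

definition complementary :: "(complex^'n^'n) list \<Rightarrow> nat \<Rightarrow> complex^'n^'n" where
  "complementary As i = (\<Sum>j\<in>{..<length As} - {i}. As ! j)"

definition dich_err :: "(complex^'n^'n) list \<Rightarrow> real" where
  "dich_err As = (\<Sum>i<length As. opt_err [As ! i, complementary As i])"

lemma cinner_add: "cinner v (x + y) = cinner v x + cinner v y"
  by (simp add: cinner_def algebra_simps sum.distrib)

lemma psd_0: "psd 0"
  by (simp add: psd_def cinner_def)

lemma psd_add: "psd A \<Longrightarrow> psd B \<Longrightarrow> psd (A + B)"
  by (simp add: psd_def matrix_vector_mult_add_rdistrib cinner_add nonneg_Reals_add_I)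

lemma psd_sum: "(\<And>i. i \<in> S \<Longrightarrow> psd (f i)) \<Longrightarrow> psd (sum f S)"
  by (induction S rule: infinite_finite_induct) (auto simp: psd_0 psd_add)

lemma cinner_self: "cinner v v = of_real (\<Sum>i\<in>UNIV. (cmod (v $ i))\<^sup>2)"
  unfolding cinner_def of_real_sum
  by (intro sum.cong refl) (metis complex_norm_square mult.commute of_real_power)

lemma psd_mat1: "psd (mat 1)"
  by (auto simp: psd_def cinner_self simp del: of_real_sum intro!: sum_nonneg)

lemma psd_le_1_entry_bound:
  fixes E :: "complex^'n^'n"
  assumes "psd E" "psd (mat 1 - E)"
  shows "cmod (E $ i $ j) \<le> 8"
proof -
  have q: "cmod (cinner v (E *v v)) \<le> (\<Sum>k\<in>UNIV. (cmod (v $ k))\<^sup>2)" for v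
  proof -
    have a: "cinner v (E *v v) \<in> \<real>\<^sub>\<ge>\<^sub>0" using assms(1) by (simp add: psd_def)
    have "cinner v ((mat 1 - E) *v v) \<in> \<real>\<^sub>\<ge>\<^sub>0" using assms(2) by (simp add: psd_def)
    moreover have "cinner v ((mat 1 - E) *v v) + cinner v (E *v v) = cinner v v"
      by (simp add: cinner_add[symmetric] matrix_vector_mult_add_rdistrib[symmetric])
    ultimately have "cinner v v - cinner v (E *v v) \<in> \<real>\<^sub>\<ge>\<^sub>0" by (metis add_diff_cancel_right')
    hence "Re (cinner v (E *v v)) \<le> Re (cinner v v)"
      by (auto simp: complex_nonneg_Reals_iff)
    moreover have "cmod (cinner v (E *v v)) = Re (cinner v (E *v v))"
      using a by (auto simp: complex_nonneg_Reals_iff cmod_eq_Re)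
    ultimately show ?thesis by (simp add: cinner_self)
  qed
  define e :: "complex \<Rightarrow> complex^'n" where "e c = axis i 1 + c *s axis j 1" for c
  have e_q: "cinner (e c) (E *v e c) = E $ i $ i + c * E $ i $ j + cnj c * E $ j $ i + cnj c * c * E $ j $ j" for c
  proof -
    have "(E *v e c) $ k = E $ k $ i + c * E $ k $ j" for k
    proof -
      have "(E *v e c) $ k = (\<Sum>l\<in>UNIV. (if l = i then E $ k $ l else 0) + (if l = j then c * E $ k $ l else 0))"
        unfolding matrix_vector_mult_def vec_lambda_beta
        by (intro sum.cong refl) (auto simp: e_def axis_def algebra_simps)
      thus ?thesis by (simp add: sum.distrib)
    qed
    hence "cinner (e c) (E *v e c) = (\<Sum>k\<in>UNIV. (if k = i then E $ k $ i + c * E $ k $ j else 0)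
        + (if k = j then cnj c * (E $ k $ i + c * E $ k $ j) else 0))"
      unfolding cinner_def
      by (intro sum.cong refl) (auto simp: e_def axis_def algebra_simps)
    thus ?thesis by (simp add: sum.distrib algebra_simps)
  qed
  have e_n: "(\<Sum>k\<in>UNIV. (cmod (e c $ k))\<^sup>2) \<le> 8" if "cmod c = 1" for c
  proof -
    have "(cmod (e c $ k))\<^sup>2 \<le> (if k = i then 4 else 0) + (if k = j then 4 else 0)" for k
    proof -
      have "cmod (e c $ k) \<le> 2"
        unfolding e_def using that norm_triangle_ineq[of 1 c] by (auto simp: axis_def)
      hence "(cmod (e c $ k))\<^sup>2 \<le> 2\<^sup>2"
        by (intro power_mono) auto
      moreover have "e c $ k = 0" if "k \<noteq> i" "k \<noteq> j"
        using that by (simp add: e_def axis_def)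
      ultimately show ?thesis by (auto simp del: power_mono_iff)
    qed
    hence "(\<Sum>k\<in>UNIV. (cmod (e c $ k))\<^sup>2) \<le> (\<Sum>k\<in>UNIV. (if k = i then 4 else 0) + (if k = j then 4 else 0))"
      by (intro sum_mono)
    thus ?thesis by (simp add: sum.distrib)
  qed
  have b: "cmod (cinner (e c) (E *v e c)) \<le> 8" if "cmod c = 1" for c
    using q[of "e c"] e_n[OF that] by linarith
  have "4 * E $ i $ j = cinner (e 1) (E *v e 1) - cinner (e (-1)) (E *v e (-1))
     - \<i> * cinner (e \<i>) (E *v e \<i>) + \<i> * cinner (e (-\<i>)) (E *v e (-\<i>))"
    unfolding e_q by (simp add: algebra_simps)
  also have "cmod \<dots> \<le> 8 + 8 + 8 + 8"
    by (intro order.trans[OF norm_triangle_ineq] order.trans[OF norm_triangle_ineq4] add_mono)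
      (auto simp: norm_mult b)
  finally show ?thesis by (simp add: norm_mult)
qed

lemma closed_psd: "closed {E :: complex^'n^'n. psd E}"
proof -
  have "closed {E :: complex^'n^'n. cinner v (E *v v) \<in> \<real>\<^sub>\<ge>\<^sub>0}" for v
    unfolding cinner_def matrix_vector_mult_def vec_lambda_beta
    by (intro continuous_closed_vimage[of "\<real>\<^sub>\<ge>\<^sub>0", unfolded vimage_def] closed_nonneg_Reals_complex
        continuous_intros)
  thus ?thesis unfolding psd_def by (intro closed_Collect_all) auto
qed

lemma compact_effects: "compact {E :: complex^'n^'n. psd E \<and> psd (mat 1 - E)}"
proof -
  let ?K = "{E :: complex^'n^'n. psd E \<and> psd (mat 1 - E)}"
  have "closed {E :: complex^'n^'n. psd (mat 1 - E)}"
    using continuous_closed_vimage[OF closed_psd, of "\<lambda>E. mat 1 - E"]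
    by (auto simp: vimage_def)
  hence "closed ?K" using closed_psd by (intro closed_Collect_conj) auto
  moreover have "norm E \<le> (\<Sum>(i::'n)\<in>UNIV. \<Sum>(j::'n)\<in>UNIV. 8)" if "E \<in> ?K" for E
  proof -
    have "norm E \<le> (\<Sum>i\<in>UNIV. norm (E $ i))"
      unfolding norm_vec_def by (rule L2_set_le_sum) auto
    also have "\<dots> \<le> (\<Sum>i\<in>UNIV. \<Sum>j\<in>UNIV. norm (E $ i $ j))"
      by (rule sum_mono, subst norm_vec_def, rule L2_set_le_sum) auto
    also have "\<dots> \<le> (\<Sum>(i::'n)\<in>UNIV. \<Sum>(j::'n)\<in>UNIV. 8)"
      using that psd_le_1_entry_bound[of E] by (intro sum_mono) auto
    finally show ?thesis .
  qed
  hence "bounded ?K" unfolding bounded_iff by blast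
  ultimately show ?thesis by (simp add: compact_eq_bounded_closed)
qed

lemma povm_err_min_exists:
  fixes As :: "(complex^'n^'n) list"
  shows "\<exists>Es. length Es = length As \<and> povm Es \<and>
    (\<forall>Fs. length Fs = length As \<and> povm Fs \<longrightarrow> povm_err As Es \<le> povm_err As Fs)"
proof -
  let ?K = "{E :: complex^'n^'n. psd E \<and> psd (mat 1 - E)}"
  define m where "m = length As"
  define X where "X i = (if i < m then ?K else {0})" for i
  have "compactin (product_topology (\<lambda>i::nat. euclidean) UNIV) (Pi\<^sub>E UNIV X)"
    by (subst compactin_PiE) (auto simp: X_def compact_effects)
  hence cX: "compact (Pi\<^sub>E UNIV X)" by (simp add: euclidean_product_topology)
  have cc: "continuous_on UNIV (\<lambda>E :: nat \<Rightarrow> complex^'n^'n. E i)" for i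
    by (rule continuous_on_product_coordinates)
  define C where "C = {E :: nat \<Rightarrow> complex^'n^'n. psd (mat 1 - (\<Sum>i<m. E i))}"
  have "continuous_on UNIV (\<lambda>E :: nat \<Rightarrow> complex^'n^'n. mat 1 - (\<Sum>i<m. E i))"
    by (intro continuous_on_diff continuous_on_const continuous_on_sum cc)
  hence "closed C"
    using closed_vimage[OF closed_psd] unfolding C_def by (auto simp: vimage_def)
  hence cP: "compact (Pi\<^sub>E UNIV X \<inter> C)" using cX by (rule compact_Int_closed[rotated])
  have ne: "Pi\<^sub>E UNIV X \<inter> C \<noteq> {}"
  proof -
    have "(\<lambda>_. 0) \<in> Pi\<^sub>E UNIV X \<inter> C"
      by (auto simp: X_def C_def psd_0 psd_mat1)
    thus ?thesis by blast
  qed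
  define f where "f E = (\<Sum>i<m. Re (trace (As ! i ** (mat 1 - E i))))" for E
  have "continuous_on UNIV (\<lambda>E :: nat \<Rightarrow> complex^'n^'n. E i $ k $ l)" for i k l
    by (intro continuous_on_component cc)
  hence "continuous_on UNIV f" unfolding f_def trace_def matrix_matrix_mult_def vec_lambda_beta
    vector_minus_component
    by (intro continuous_on_sum continuous_on_Re continuous_on_mult continuous_on_diff continuous_on_const)
  hence "continuous_on (Pi\<^sub>E UNIV X \<inter> C) f" by (rule continuous_on_subset) auto
  from continuous_attains_inf[OF cP ne this]
  obtain E where E1: "E \<in> Pi\<^sub>E UNIV X \<inter> C" and E2: "\<forall>F \<in> Pi\<^sub>E UNIV X \<inter> C. f E \<le> f F"
    by (elim bexE)
  define Es where "Es = map E [0..<m]"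
  have Es_len: "length Es = m" and Es_nth: "\<And>i. i < m \<Longrightarrow> Es ! i = E i"
    by (auto simp: Es_def)
  have err: "povm_err As Es = f E"
    by (simp add: povm_err_def f_def m_def[symmetric] Es_nth)
  have "sum_list Es = (\<Sum>i<m. E i)"
    by (simp add: sum_list_sum_nth Es_len Es_nth atLeast0LessThan)
  hence Es_povm: "povm Es"
    using E1 by (auto simp: povm_def loewner_le_def C_def Es_def X_def PiE_def Pi_def split: if_splits)
  have "f E \<le> povm_err As Fs" if Fs: "length Fs = m" "povm Fs" for Fs
  proof -
    define F where "F i = (if i < m then Fs ! i else 0)" for i
    have sF: "sum_list Fs = (\<Sum>i<m. F i)"
      by (simp add: sum_list_sum_nth Fs F_def atLeast0LessThan)
    have p: "psd (F i)" for i
      using Fs by (auto simp: F_def povm_def psd_0)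
    have s: "psd (mat 1 - (\<Sum>i<m. F i))"
      using Fs sF by (simp add: povm_def loewner_le_def)
    have "psd (mat 1 - F i)" if "i < m" for i
    proof -
      have "mat 1 - F i = (mat 1 - (\<Sum>i<m. F i)) + (\<Sum>j\<in>{..<m} - {i}. F j)"
        using that by (simp add: sum_diff1)
      thus ?thesis by (metis psd_add[OF s psd_sum] p)
    qed
    hence "F i \<in> X i" for i
      using p[of i] by (auto simp: X_def F_def)
    hence "F \<in> Pi\<^sub>E UNIV X \<inter> C"
      using s by (auto simp: C_def)
    hence "f E \<le> f F" by (rule bspec[OF E2])
    also have "f F = povm_err As Fs" by (simp add: f_def povm_err_def m_def[symmetric] F_def)
    finally show ?thesis .
  qed
  thus ?thesis using Es_povm Es_len err unfolding m_def by metis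
qed

lemma opt_err_attained:
  "\<exists>Es. length Es = length As \<and> povm Es \<and> opt_err As = povm_err As Es"
  and opt_err_le: "length Fs = length As \<Longrightarrow> povm Fs \<Longrightarrow> opt_err As \<le> povm_err As Fs"
proof -
  obtain Es where Es: "length Es = length As" "povm Es"
    "\<And>Fs. length Fs = length As \<Longrightarrow> povm Fs \<Longrightarrow> povm_err As Es \<le> povm_err As Fs"
    using povm_err_min_exists by blast
  have eq: "opt_err As = povm_err As Es"
    unfolding opt_err_def by (rule cInf_eq_minimum) (use Es in auto)
  show "\<exists>Es. length Es = length As \<and> povm Es \<and> opt_err As = povm_err As Es"
    using Es eq by blast
  show "length Fs = length As \<Longrightarrow> povm Fs \<Longrightarrow> opt_err As \<le> povm_err As Fs"
    using Es(3) eq by simp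
qed

end

theory Submission
  imports Defs
begin

text \<open>
  An optimal POVM for $A_1,\dots,A_r$ yields the binary tests $(E_i, I - E_i)$, whose errors sum to
  at most twice the optimal one; the pairwise bound is monotonicity of the binary error.

  For the last inequality let $T = \sum_i A_i + \varepsilon I$ and let $E_i$ solve the Lyapunov
  equation $T E_i + E_i T = 2 A_i$. The $E_i$ form a POVM. As
  $\mathrm{Tr}\, T (E_i - F)^2 \ge 0$ and $F^2 \le F$ for every $0 \le F \le I$, we get
  $\mathrm{Tr}\, A_i E_i \ge \mathrm{Tr}\, (2 A_i - T) F$, that is, the error of $E_i$ at $A_i$ is at
  most that of the test $(F, I - F)$ for $A_i$ against its complement, up to a term of order
  $\varepsilon$. This measurement replaces the pretty good measurement and avoids operator square
  roots.
\<close>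

section \<open>Matrix algebra, adjoints and the inner product\<close>

definition cadj :: "complex^'n^'n \<Rightarrow> complex^'n^'n" where
  "cadj A = (\<chi> i j. cnj (A $ j $ i))"

lemma matrix_add_rdistrib: "((A :: complex^'n^'n) + B) ** C = A ** C + B ** C"
  by (simp add: matrix_matrix_mult_def vec_eq_iff algebra_simps sum.distrib)

lemma matrix_sub_ldistrib: "(A :: complex^'n^'n) ** (B - C) = A ** B - A ** C"
  by (simp add: matrix_matrix_mult_def vec_eq_iff algebra_simps sum_subtractf)

lemma matrix_sub_rdistrib: "((A :: complex^'n^'n) - B) ** C = A ** C - B ** C"
  by (simp add: matrix_matrix_mult_def vec_eq_iff algebra_simps sum_subtractf)

lemma cadj_cadj [simp]: "cadj (cadj A) = A"
  by (simp add: cadj_def vec_eq_iff)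

lemma cadj_add: "cadj (A + B) = cadj A + cadj B"
  by (simp add: cadj_def vec_eq_iff)

lemma cadj_diff: "cadj (A - B) = cadj A - cadj B"
  by (simp add: cadj_def vec_eq_iff)

lemma cadj_mult: "cadj (A ** B) = cadj B ** cadj A"
  by (simp add: cadj_def vec_eq_iff matrix_matrix_mult_def mult.commute)

lemma cadj_mat: "cadj (mat c) = mat (cnj c)"
  by (simp add: cadj_def vec_eq_iff mat_def)

lemma cinner_scale: "cinner v (c *s w) = c * cinner v w"
  by (simp add: cinner_def sum_distrib_left algebra_simps)

lemma cnj_cinner: "cnj (cinner v w) = cinner w v"
  by (simp add: cinner_def mult.commute)

lemma cinner_scale_left: "cinner (c *s v) w = cnj c * cinner v w"
  by (simp add: cinner_def sum_distrib_left algebra_simps)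

lemma cinner_add_left: "cinner (u + v) w = cinner u w + cinner v w"
  by (simp add: cinner_def algebra_simps sum.distrib)

lemma cinner_diff: "cinner v (x - y) = cinner v x - cinner v y"
  by (simp add: cinner_def algebra_simps sum_subtractf)

lemma cinner_diff_left: "cinner (u - v) w = cinner u w - cinner v w"
  by (simp add: cinner_def algebra_simps sum_subtractf)

lemma cinner_self_norm: "cinner v v = of_real ((norm v)\<^sup>2)"
  by (simp add: cinner_self norm_vec_def L2_set_def sum_nonneg)

lemma cinner_cadj: "cinner (A *v v) w = cinner v (cadj A *v w)"
proof -
  have "cinner (A *v v) w = (\<Sum>i\<in>UNIV. \<Sum>j\<in>UNIV. cnj (A $ i $ j) * cnj (v $ j) * w $ i)"
    by (simp add: cinner_def matrix_vector_mult_def sum_distrib_right)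
  also have "\<dots> = (\<Sum>j\<in>UNIV. \<Sum>i\<in>UNIV. cnj (A $ i $ j) * cnj (v $ j) * w $ i)"
    by (rule sum.swap)
  also have "\<dots> = cinner v (cadj A *v w)"
    by (simp add: cinner_def matrix_vector_mult_def cadj_def sum_distrib_left mult_ac)
  finally show ?thesis .
qed

lemma cinner_axis: "cinner (axis i 1) v = v $ i"
proof -
  have "cinner (axis i 1) v = (\<Sum>k\<in>UNIV. if k = i then v $ k else 0)"
    unfolding cinner_def by (intro sum.cong refl) (auto simp: axis_def)
  thus ?thesis by simp
qed

lemma matrix_axis: "(A *v axis j 1) $ i = (A :: complex^'n^'n) $ i $ j"
proof -
  have "(A *v axis j 1) $ i = (\<Sum>k\<in>UNIV. if k = j then A $ i $ k else 0)"
    unfolding matrix_vector_mult_def vec_lambda_beta by (intro sum.cong refl) (auto simp: axis_def)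
  thus ?thesis by simp
qed

section \<open>Positive semidefinite operators\<close>

lemma psd_form_sym:
  assumes "psd A"
  shows "cinner w (A *v v) = cnj (cinner v (A *v w))"
proof -
  have im: "Im (cinner x (A *v x)) = 0" for x
    using assms by (auto simp: psd_def complex_nonneg_Reals_iff)
  \<comment> \<open>Polarization: the form is real at \<open>v\<close>, \<open>x\<close> and
    \<open>v + x\<close>. Below, \<open>x = w\<close> compares imaginary parts and
    \<open>x = \<i> *s w\<close> real parts.\<close>
  have "Im (cinner v (A *v x) + cinner x (A *v v)) = 0" for x
    using im[of "v + x"] im[of v] im[of x]
    by (simp add: matrix_vector_right_distrib cinner_add cinner_add_left)
  from this[of w] this[of "\<i> *s w"] show ?thesis
    by (simp add: complex_eq_iff matrix_vector_mult_scaleR vector_scalar_commute cinner_scale cinner_scale_left)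
qed

lemma psd_cadj: "psd A \<Longrightarrow> cadj A = A"
proof -
  assume "psd A"
  hence "cnj (A $ j $ i) = A $ i $ j" for i j
    using psd_form_sym[of A "axis i 1" "axis j 1"] by (simp add: cinner_axis matrix_axis)
  thus ?thesis by (simp add: cadj_def vec_eq_iff)
qed

lemma psd_Re: "psd A \<Longrightarrow> 0 \<le> Re (cinner v (A *v v))"
  by (auto simp: psd_def complex_nonneg_Reals_iff)

text \<open>Self-adjointness makes the form equal to its own conjugate, so only its real part has to
  be checked.\<close>

lemma psdI:
  assumes "cadj A = A" "\<And>v. 0 \<le> Re (cinner v (A *v v))"
  shows "psd A"
proof -
  have "cnj (cinner v (A *v v)) = cinner v (A *v v)" for v
    by (metis assms(1) cinner_cadj cnj_cinner)
  hence "Im (cinner v (A *v v)) = 0" for v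
    by (simp add: complex_eq_iff)
  thus ?thesis using assms(2) by (auto simp: psd_def complex_nonneg_Reals_iff)
qed

lemma psd_conj:
  assumes "psd A"
  shows "psd (cadj D ** A ** D)"
proof -
  have "cinner v ((cadj D ** A ** D) *v v) = cinner (D *v v) (A *v (D *v v))" for v
    by (simp add: cinner_cadj matrix_vector_mul_assoc matrix_mul_assoc)
  thus ?thesis using assms by (simp add: psd_def)
qed

lemma psd_cadj_mult: "psd (cadj D ** D)"
  using psd_conj[OF psd_mat1, of D] by simp

text \<open>F - F^2 = F (I - F) F + (I - F) F (I - F), a sum of two congruences of psd
  operators.\<close>

lemma psd_effect_diff_square:
  assumes "psd F" "psd (mat 1 - F)"
  shows "psd (F - F ** F)"
proof -
  have "psd (F ** (mat 1 - F) ** F + (mat 1 - F) ** F ** (mat 1 - F))"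
    using psd_add[OF psd_conj[OF assms(2), of F] psd_conj[OF assms(1), of "mat 1 - F"]]
      psd_cadj[OF assms(1)] psd_cadj[OF assms(2)] by simp
  also have "F ** (mat 1 - F) ** F + (mat 1 - F) ** F ** (mat 1 - F) = F - F ** F"
    by (simp add: matrix_sub_ldistrib matrix_sub_rdistrib matrix_mul_assoc)
  finally show ?thesis .
qed

text \<open>With w = A u, the form at u - t w is t^2 Q - 2 t N, where N is the squared norm of w.
  For small t > 0 this is negative unless w = 0.\<close>

lemma psd_kernel:
  assumes "psd A" "Re (cinner u (A *v u)) = 0"
  shows "A *v u = 0"
proof -
  define w where "w = A *v u"
  define N where "N = (norm w)\<^sup>2"
  define Q where "Q = Re (cinner w (A *v w))"
  have Q: "0 \<le> Q" unfolding Q_def by (rule psd_Re[OF assms(1)])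
  have N: "0 \<le> N" by (simp add: N_def)
  \<comment> \<open>Any t strictly between 0 and 2 N / Q would do; the \<open>+ 1\<close> covers Q =
    0.\<close>
  define t where "t = N / (Q + 1)"
  have 1: "cinner w (A *v u) = of_real N"
    by (simp add: N_def w_def cinner_self_norm)
  have 2: "cinner u (A *v w) = of_real N"
    using psd_form_sym[OF assms(1), of u w] 1 by simp
  have "0 \<le> Re (cinner (u - of_real t *s w) (A *v (u - of_real t *s w)))"
    by (rule psd_Re[OF assms(1)])
  also have "\<dots> = t * t * Q - 2 * t * N"
    using assms(2) by (simp add: matrix_vector_mult_diff_distrib vector_scalar_commute cinner_diff
        cinner_diff_left cinner_scale cinner_scale_left 1 2 Q_def algebra_simps)
  also have "\<dots> = t * t * (Q - 2 * (Q + 1))"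
  proof -
    have "N = t * (Q + 1)" using Q by (simp add: t_def)
    thus ?thesis by (simp add: algebra_simps)
  qed
  finally have "0 \<le> t * t * (- Q - 2)" by simp
  hence "t * t \<le> 0"
    using Q by (simp add: zero_le_mult_iff)
  hence "t = 0" by (auto simp: mult_le_0_iff)
  hence "N = 0" using Q by (simp add: t_def)
  thus ?thesis by (simp add: N_def w_def)
qed

section \<open>The trace of a product of two psd operators\<close>

lemma psd_sub_rank_one:
  assumes "psd A" "Re (cinner u (A *v u)) > 0"
  defines "w \<equiv> A *v u" and "a \<equiv> Re (cinner u (A *v u))"
  shows "psd (A - (\<chi> i j. w $ i * cnj (w $ j) / of_real a))"
proof (rule psdI)
  define R where "R = (\<chi> i j. w $ i * cnj (w $ j) / of_real a)"
  have "cadj R = R" by (simp add: R_def cadj_def vec_eq_iff mult.commute)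
  thus "cadj (A - R) = A - R" by (simp add: cadj_diff psd_cadj[OF assms(1)])
  fix v
  define b where "b = cinner v w"
  have a: "a > 0" using assms by simp
  have qu: "cinner u w = of_real a"
    using assms(1) unfolding a_def w_def by (auto simp: psd_def complex_nonneg_Reals_iff complex_eq_iff)
  have bu: "cinner u (A *v v) = cnj b"
    using psd_form_sym[OF assms(1), of u v] by (simp add: b_def w_def)
  have "R *v v = (cnj b / of_real a) *s w"
    by (simp add: R_def matrix_vector_mult_def vec_eq_iff b_def cinner_def sum_distrib_left
        sum_distrib_right sum_divide_distrib mult_ac)
  hence R: "cinner v (R *v v) = cnj b * b / of_real a"
    by (simp add: cinner_scale b_def)
  \<comment> \<open>Schur complement: this vector minimizes the form of \<open>A\<close> over all v
    - c u, and the minimum is the form of \<open>A - R\<close> at \<open>v\<close>.\<close>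
  have "0 \<le> Re (cinner (v - (cnj b / of_real a) *s u) (A *v (v - (cnj b / of_real a) *s u)))"
    by (rule psd_Re[OF assms(1)])
  also have "cinner (v - (cnj b / of_real a) *s u) (A *v (v - (cnj b / of_real a) *s u))
    = cinner v (A *v v) - cnj b * b / of_real a"
    using a by (simp add: matrix_vector_mult_diff_distrib vector_scalar_commute cinner_diff
        cinner_diff_left cinner_scale cinner_scale_left bu qu flip: w_def b_def)
  also have "\<dots> = cinner v ((A - R) *v v)"
    by (simp add: matrix_vector_mult_diff_rdistrib cinner_diff R)
  finally show "0 \<le> Re (cinner v ((A - R) *v v))" .
qed

lemma trace_rank_one_mult:
  "trace ((\<chi> i j. w $ i * cnj (w $ j) / c) ** B) = cinner w (B *v w) / c"
proof -
  have "trace ((\<chi> i j. w $ i * cnj (w $ j) / c) ** B)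
    = (\<Sum>i\<in>UNIV. \<Sum>k\<in>UNIV. w $ i * cnj (w $ k) / c * B $ k $ i)"
    by (simp add: trace_def matrix_matrix_mult_def)
  also have "\<dots> = (\<Sum>k\<in>UNIV. \<Sum>i\<in>UNIV. w $ i * cnj (w $ k) / c * B $ k $ i)"
    by (rule sum.swap)
  also have "\<dots> = cinner w (B *v w) / c"
    by (simp add: cinner_def matrix_vector_mult_def sum_distrib_left sum_divide_distrib mult_ac)
  finally show ?thesis .
qed

text \<open>Cholesky elimination: each step splits off a rank-one operator and clears one diagonal entry.\<close>

lemma psd_trace_mult_nonneg:
  fixes A B :: "complex^'n^'n"
  assumes "psd A" "psd B"
  shows "0 \<le> Re (trace (A ** B))"
  using assms(1)
proof (induction "card {k. A $ k $ k \<noteq> 0}" arbitrary: A rule: less_induct)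
  case less
  show ?case
  proof (cases "\<exists>k. A $ k $ k \<noteq> 0")
    case False
    have "A *v axis k 1 = 0" for k
      using False by (intro psd_kernel[OF less.prems]) (simp add: cinner_axis matrix_axis)
    hence "A $ i $ k = 0" for i k
      by (metis matrix_axis zero_index)
    hence "A = 0" by (simp add: vec_eq_iff)
    thus ?thesis by (simp add: trace_def matrix_matrix_mult_def)
  next
    case True
    then obtain k where k: "A $ k $ k \<noteq> 0" by blast
    define w where "w = A *v axis k 1"
    have w: "w $ i = A $ i $ k" for i by (simp add: w_def matrix_axis)
    have kk: "cinner (axis k 1) (A *v axis k 1) = A $ k $ k"
      by (simp add: cinner_axis matrix_axis)
    have "A $ k $ k \<in> \<real>\<^sub>\<ge>\<^sub>0"
      using less.prems kk unfolding psd_def by metis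
    then obtain a where a: "A $ k $ k = of_real a" "a > 0"
      using k by (elim nonneg_Reals_cases) (auto simp: order_le_less)
    define R where "R = (\<chi> i j. w $ i * cnj (w $ j) / of_real a)"
    have "Re (cinner (axis k 1) (A *v axis k 1)) = a"
      by (simp add: kk a)
    hence psdR: "psd (A - R)"
      using psd_sub_rank_one[OF less.prems, of "axis k 1"] a by (simp add: R_def w_def)
    \<comment> \<open>A zero diagonal entry forces its whole row and column to vanish, so
      subtracting \<open>R\<close> keeps it zero and no new nonzero diagonal entry appears.\<close>
    have diag: "A $ j $ j = 0 \<Longrightarrow> w $ j = 0" for j
    proof -
      assume "A $ j $ j = 0"
      hence "A *v axis j 1 = 0"
        by (intro psd_kernel[OF less.prems]) (simp add: cinner_axis matrix_axis)
      hence "A $ k $ j = 0" by (metis matrix_axis zero_index)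
      moreover have "w $ j = cnj (A $ k $ j)"
        using psd_cadj[OF less.prems] by (simp add: w cadj_def vec_eq_iff)
      ultimately show ?thesis by simp
    qed
    have "{j. (A - R) $ j $ j \<noteq> 0} \<subset> {j. A $ j $ j \<noteq> 0}"
    proof
      show "{j. (A - R) $ j $ j \<noteq> 0} \<subseteq> {j. A $ j $ j \<noteq> 0}"
        using diag by (auto simp: R_def)
      have "(A - R) $ k $ k = 0"
        using a by (simp add: R_def w)
      thus "{j. (A - R) $ j $ j \<noteq> 0} \<noteq> {j. A $ j $ j \<noteq> 0}"
        using k by blast
    qed
    hence "card {j. (A - R) $ j $ j \<noteq> 0} < card {j. A $ j $ j \<noteq> 0}"
      by (intro psubset_card_mono) auto
    from less.hyps[OF this psdR] have "0 \<le> Re (trace ((A - R) ** B))" .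
    moreover have "0 \<le> Re (trace (R ** B))"
      using a psd_Re[OF assms(2), of w] by (simp add: R_def trace_rank_one_mult)
    ultimately show ?thesis by (simp add: matrix_sub_rdistrib trace_sub)
  qed
qed

section \<open>The Lyapunov equation for a strictly positive operator\<close>

lemma trace_mat_mult: "trace (mat c ** (A :: complex^'n^'n)) = c * trace A"
proof -
  have "(mat c ** A) $ i $ i = c * A $ i $ i" for i
  proof -
    have "(mat c ** A) $ i $ i = (\<Sum>k\<in>UNIV. if k = i then c * A $ k $ i else 0)"
      unfolding matrix_matrix_mult_def vec_lambda_beta by (intro sum.cong refl) (auto simp: mat_def)
    thus ?thesis by simp
  qed
  thus ?thesis by (simp add: trace_def sum_distrib_left)
qed

lemma trace_cadj_mult: "trace (cadj D ** D) = of_real (\<Sum>i\<in>UNIV. \<Sum>k\<in>UNIV. (cmod (D $ k $ i))\<^sup>2)"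
  unfolding trace_def of_real_sum
  by (simp add: matrix_matrix_mult_def cadj_def complex_norm_square mult.commute del: of_real_power)

lemma mat_vector_mult: "mat c *v (v :: complex^'n) = c *s v"
proof -
  have "(mat c *v v) $ i = (\<Sum>k\<in>UNIV. if k = i then c * v $ k else 0)" for i
    unfolding matrix_vector_mult_def vec_lambda_beta by (intro sum.cong refl) (auto simp: mat_def)
  thus ?thesis by (simp add: vec_eq_iff)
qed

lemma psd_mat_of_real: "0 \<le> c \<Longrightarrow> psd (mat (of_real c))"
  by (rule psdI) (simp_all add: cadj_mat mat_vector_mult cinner_scale cinner_self_norm
      flip: of_real_power)

text \<open>Multiplying by D* and taking the trace gives Tr T D D* + Tr T D* D = 0, while each term
  is at least \<open>e\<close> times the squared Frobenius norm \<open>N\<close> of its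
  factor.\<close>

lemma lyapunov_inj:
  fixes S D :: "complex^'n^'n" and e :: real
  assumes "psd S" "e > 0" "T = S + mat (of_real e)" "T ** D + D ** T = 0"
  shows "D = 0"
proof -
  define N where "N D = (\<Sum>i\<in>UNIV. \<Sum>k\<in>UNIV. (cmod (D $ k $ i))\<^sup>2)" for D :: "complex^'n^'n"
  have N0: "0 \<le> N X" for X by (simp add: N_def sum_nonneg)
  have N: "Re (trace (T ** (cadj X ** X))) \<ge> e * N X" for X
    using psd_trace_mult_nonneg[OF assms(1) psd_cadj_mult[of X]]
    by (simp add: assms(3) matrix_add_rdistrib trace_add trace_mat_mult trace_cadj_mult N_def)
  have "0 = trace ((T ** D + D ** T) ** cadj D)"
    unfolding assms(4) by (simp add: trace_def matrix_matrix_mult_def)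
  also have "\<dots> = trace (T ** (D ** cadj D)) + trace (D ** (T ** cadj D))"
    by (simp add: matrix_add_rdistrib trace_add matrix_mul_assoc)
  also have "trace (D ** (T ** cadj D)) = trace (T ** (cadj D ** D))"
    by (subst trace_mul_sym) (simp add: matrix_mul_assoc)
  finally have "Re (trace (T ** (D ** cadj D))) + Re (trace (T ** (cadj D ** D))) = 0"
    by (metis plus_complex.simps(1) zero_complex.simps(1))
  with N[of D] N[of "cadj D"] have "e * N D + e * N (cadj D) \<le> 0" by simp
  hence "N D \<le> 0"
    using assms(2) N0[of D] N0[of "cadj D"] by (simp add: mult_le_0_iff flip: distrib_left)
  hence "N D = 0" using N0[of D] by simp
  hence "D $ k $ i = 0" for k i
    unfolding N_def by (simp add: sum_nonneg_eq_0_iff sum_nonneg)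
  thus ?thesis by (simp add: vec_eq_iff)
qed

text \<open>By compactness the form attains a minimum m on the unit sphere. Then E - m I is psd and
  its form vanishes at the minimizer, which \<open>psd_kernel\<close> turns into an
  eigenvector.\<close>

lemma hermitian_min_eigenvector:
  fixes E :: "complex^'n^'n"
  assumes "cadj E = E"
  obtains v m where "norm v = 1" "E *v v = of_real m *s v" "psd (E - mat (of_real m))"
proof -
  define q where "q v = Re (cinner v (E *v v))" for v
  have "continuous_on (sphere 0 1) q"
    unfolding q_def cinner_def matrix_vector_mult_def vec_lambda_beta by (intro continuous_intros)
  moreover have "sphere (0 :: complex^'n) 1 \<noteq> {}"
    by simp
  ultimately obtain v where v: "norm v = 1" "\<And>w. norm w = 1 \<Longrightarrow> q v \<le> q w"
    using continuous_attains_inf[of "sphere 0 1" q] by (auto simp: dist_norm)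
  have q: "q v * (norm w)\<^sup>2 \<le> q w" for w
  proof (cases "w = 0")
    case True
    thus ?thesis by (simp add: q_def cinner_def)
  next
    case False
    define c where "c = complex_of_real (1 / norm w)"
    have cw: "c *s w = (1 / norm w) *\<^sub>R w" by (simp add: c_def vec_eq_iff) (simp add: scaleR_conv_of_real)
    have "q v \<le> q (c *s w)"
      by (rule v(2)) (use False in \<open>simp add: cw\<close>)
    also have "\<dots> = q w / (norm w)\<^sup>2"
      by (simp add: q_def c_def vector_scalar_commute cinner_scale cinner_scale_left power2_eq_square
          flip: of_real_divide of_real_mult)
    finally show ?thesis using False by (simp add: field_simps)
  qed
  have form: "Re (cinner w ((E - mat (of_real (q v))) *v w)) = q w - q v * (norm w)\<^sup>2" for w
    by (simp add: matrix_vector_mult_diff_rdistrib cinner_diff mat_vector_mult cinner_scale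
        cinner_self_norm q_def flip: of_real_power of_real_mult)
  have psd: "psd (E - mat (of_real (q v)))"
    by (rule psdI) (use q in \<open>auto simp: cadj_diff cadj_mat assms form\<close>)
  have "(E - mat (of_real (q v))) *v v = 0"
    by (rule psd_kernel[OF psd]) (simp add: form v(1))
  hence "E *v v = of_real (q v) *s v"
    by (simp add: matrix_vector_mult_diff_rdistrib mat_vector_mult)
  with v(1) show thesis using psd by (rule that)
qed

text \<open>At an eigenvector v for the least eigenvalue m of E, the form of T E + E T equals 2 m
  times the positive number <v, T v>, so m >= 0.\<close>

lemma lyapunov_psd:
  fixes S E :: "complex^'n^'n" and e :: real
  assumes "psd S" "e > 0" and T: "T = S + mat (of_real e)" and M: "psd (T ** E + E ** T)"
  shows "psd E"
proof -
  have cT: "cadj T = T" by (simp add: T cadj_add cadj_mat psd_cadj[OF assms(1)])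
  \<comment> \<open>E and its adjoint solve the same equation, so uniqueness makes E
    self-adjoint.\<close>
  have "cadj (T ** E + E ** T) = T ** E + E ** T" by (rule psd_cadj[OF M])
  hence "T ** (E - cadj E) + (E - cadj E) ** T = 0"
    by (simp add: cadj_add cadj_mult cT matrix_sub_ldistrib matrix_sub_rdistrib algebra_simps)
  hence "E - cadj E = 0" by (rule lyapunov_inj[OF assms(1,2) T])
  hence cE: "cadj E = E" by simp
  then obtain v m where v: "norm v = 1" "E *v v = of_real m *s v" "psd (E - mat (of_real m))"
    by (rule hermitian_min_eigenvector)
  have "cinner v ((T ** E + E ** T) *v v) = cinner v (T *v (E *v v)) + cinner (E *v v) (T *v v)"
    by (simp add: matrix_vector_mult_add_rdistrib cinner_add cinner_cadj cE matrix_vector_mul_assoc)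
  also have "\<dots> = 2 * of_real m * cinner v (T *v v)"
    by (simp add: v(2) vector_scalar_commute cinner_scale cinner_scale_left)
  finally have "0 \<le> m * Re (cinner v (T *v v))"
    using psd_Re[OF M, of v] by simp
  moreover have "Re (cinner v (T *v v)) > 0"
    using psd_Re[OF assms(1), of v] assms(2) v(1)
    by (simp add: T matrix_vector_mult_add_rdistrib cinner_add mat_vector_mult cinner_scale cinner_self_norm)
  ultimately have "0 \<le> m" by (simp add: zero_le_mult_iff)
  from psd_add[OF v(3) psd_mat_of_real[OF this]] show ?thesis by simp
qed

text \<open>An injective linear map of a finite-dimensional space into itself is surjective.\<close>

lemma lyapunov_solution:
  fixes S A :: "complex^'n^'n" and e :: real
  assumes "psd S" "e > 0" "T = S + mat (of_real e)"
  shows "\<exists>E. T ** E + E ** T = A"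
proof -
  define L where "L E = T ** E + E ** T" for E
  have lin: "linear L"
  proof (rule linearI)
    show "L (X + Y) = L X + L Y" for X Y
      by (simp add: L_def matrix_add_ldistrib matrix_add_rdistrib)
    show "L (c *\<^sub>R X) = c *\<^sub>R L X" for c X
      by (simp add: L_def matrix_scalar_ac scaleR_add_right flip: scalar_matrix_assoc)
  qed
  have "X = 0" if "L X = 0" for X
    by (rule lyapunov_inj[OF assms]) (use that in \<open>simp only: L_def\<close>)
  hence "inj L" unfolding linear_injective_0[OF lin] by blast
  with lin have "surj L" by (rule linear_inj_imp_surj)
  then obtain E where "A = L E" by (rule surjE)
  thus ?thesis unfolding L_def by blast
qed

text \<open>Expanding Tr T (E - F)^2 >= 0 gives 2 Tr A F <= Tr A E + Tr T F^2, and F^2 <= F bounds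
  the last term.\<close>

lemma lyapunov_trace_bound:
  fixes T A E F :: "complex^'n^'n"
  assumes "psd T" "psd E" "psd F" "psd (mat 1 - F)" and L: "T ** E + E ** T = A + A"
  shows "2 * Re (trace (A ** F)) - Re (trace (T ** F)) \<le> Re (trace (A ** E))"
proof -
  have "cadj (E - F) = E - F"
    by (simp add: cadj_diff psd_cadj assms)
  hence "psd ((E - F) ** (E - F))"
    using psd_cadj_mult[of "E - F"] by simp
  hence "0 \<le> Re (trace (T ** ((E - F) ** (E - F))))"
    by (rule psd_trace_mult_nonneg[OF assms(1)])
  hence 1: "Re (trace (T ** E ** F)) + Re (trace (T ** F ** E))
      \<le> Re (trace (T ** E ** E)) + Re (trace (T ** F ** F))"
    by (simp add: matrix_sub_ldistrib matrix_sub_rdistrib trace_sub matrix_mul_assoc)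
  have 2: "Re (trace (T ** F ** F)) \<le> Re (trace (T ** F))"
    using psd_trace_mult_nonneg[OF assms(1) psd_effect_diff_square[OF assms(3,4)]]
    by (simp add: matrix_sub_ldistrib trace_sub matrix_mul_assoc)
  \<comment> \<open>The equation tested against X: X = F evaluates the cross terms as 2 Tr A F, and
    X = E gives Tr T E^2 = Tr A E.\<close>
  have 3: "2 * trace (A ** X) = trace (T ** E ** X) + trace (T ** X ** E)" for X
  proof -
    have "2 * trace (A ** X) = trace ((A + A) ** X)"
      by (simp only: matrix_add_rdistrib trace_add mult_2)
    also have "\<dots> = trace (T ** E ** X) + trace (E ** (T ** X))"
      by (simp add: matrix_add_rdistrib trace_add matrix_mul_assoc flip: L)
    also have "trace (E ** (T ** X)) = trace (T ** X ** E)"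
      by (rule trace_mul_sym)
    finally show ?thesis .
  qed
  have "2 * Re (trace (A ** X)) = Re (trace (T ** E ** X)) + Re (trace (T ** X ** E))" for X
    using arg_cong[OF 3[of X], of Re] by simp
  from this[of F] this[of E] 1 2 show ?thesis by simp
qed

section \<open>Binary tests and their optimal error\<close>

lemma matrix_mult_sum_left: "(\<Sum>i\<in>I. f i) ** (B :: complex^'n^'n) = (\<Sum>i\<in>I. f i ** B)"
  by (simp add: matrix_matrix_mult_def vec_eq_iff sum_distrib_right, intro allI, rule sum.swap)

lemma matrix_mult_sum_right: "(B :: complex^'n^'n) ** (\<Sum>i\<in>I. f i) = (\<Sum>i\<in>I. B ** f i)"
  by (simp add: matrix_matrix_mult_def vec_eq_iff sum_distrib_left, intro allI, rule sum.swap)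

lemma trace_sum: "trace (\<Sum>i\<in>I. f i) = (\<Sum>i\<in>I. trace (f i :: complex^'n^'n))"
  unfolding trace_def sum_component by (rule sum.swap)

lemma opt_err_pair_le:
  assumes "psd F" "psd (mat 1 - F)"
  shows "opt_err [A, B] \<le> Re (trace (A ** (mat 1 - F))) + Re (trace (B ** F))"
proof -
  have "opt_err [A, B] \<le> povm_err [A, B] [F, mat 1 - F]"
    by (rule opt_err_le) (use assms in \<open>auto simp: povm_def loewner_le_def psd_0\<close>)
  thus ?thesis by (simp add: povm_err_def numeral_2_eq_2)
qed

text \<open>An optimal pair (F, G) may sum to less than I. Enlarging G to I - F does not raise the
  error, because Tr B (I - F - G) >= 0; hence tests (F, I - F) suffice.\<close>

lemma opt_err_pair_attained:
  assumes "psd B"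
  obtains F where "psd F" "psd (mat 1 - F)"
    "Re (trace (A ** (mat 1 - F))) + Re (trace (B ** F)) = opt_err [A, B]"
proof -
  obtain Es where "length Es = 2" "povm Es" "opt_err [A, B] = povm_err [A, B] Es"
    using opt_err_attained[of "[A, B]"] by (auto simp: numeral_2_eq_2)
  moreover from this(1) obtain F G where "Es = [F, G]"
    by (auto simp: numeral_2_eq_2 length_Suc_conv)
  ultimately have F: "psd F" and G: "psd G" and FG: "psd (mat 1 - (F + G))"
    and opt: "opt_err [A, B] = Re (trace (A ** (mat 1 - F))) + Re (trace (B ** (mat 1 - G)))"
    by (auto simp: povm_def loewner_le_def povm_err_def numeral_2_eq_2)
  have F1: "psd (mat 1 - F)" using psd_add[OF FG G] by simp
  have "Re (trace (B ** F)) \<le> Re (trace (B ** (mat 1 - G)))"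
    using psd_trace_mult_nonneg[OF assms FG]
    by (simp add: matrix_sub_ldistrib matrix_add_ldistrib trace_sub trace_add)
  with opt opt_err_pair_le[OF F F1, of A B] F F1 show thesis by (intro that) auto
qed

lemma opt_err_pair_commute_le:
  assumes "psd B"
  shows "opt_err [B, A] \<le> opt_err [A, B]"
proof -
  obtain F where F: "psd F" "psd (mat 1 - F)"
    "Re (trace (A ** (mat 1 - F))) + Re (trace (B ** F)) = opt_err [A, B]"
    using opt_err_pair_attained[OF assms] by blast
  show ?thesis using opt_err_pair_le[of "mat 1 - F" B A] F by simp
qed

text \<open>The optimal test for \<open>A\<close> against \<open>C\<close> is also a test for
  \<open>A\<close> against \<open>B\<close>, and Tr (C - B) F >= 0.\<close>

lemma opt_err_pair_mono:
  assumes "psd B" "psd (C - B)"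
  shows "opt_err [A, B] \<le> opt_err [A, C]"
proof -
  have "psd C" using psd_add[OF assms] by simp
  then obtain F where F: "psd F" "psd (mat 1 - F)"
    "Re (trace (A ** (mat 1 - F))) + Re (trace (C ** F)) = opt_err [A, C]"
    using opt_err_pair_attained by blast
  have "Re (trace (B ** F)) \<le> Re (trace (C ** F))"
    using psd_trace_mult_nonneg[OF assms(2) F(1)] by (simp add: matrix_sub_rdistrib trace_sub)
  thus ?thesis using opt_err_pair_le[OF F(1,2), of A B] F(3) by simp
qed

section \<open>Pairwise error against dichotomic error\<close>

lemma sum_ordered_pairs_add:
  fixes d :: "nat \<Rightarrow> real"
  shows "(\<Sum>(k, l) \<in> {(k, l). k < l \<and> l < n}. d k + d l) = (real n - 1) * (\<Sum>i<n. d i)"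
proof (induction n)
  case (Suc n)
  have fin: "finite {(k, l). k < l \<and> l < n}"
    by (rule finite_subset[of _ "{..<n} \<times> {..<n}"]) auto
  \<comment> \<open>The new pairs have larger entry \<open>n\<close>: each old index gains one
    occurrence, and \<open>n\<close> occurs n times.\<close>
  have "{(k, l). k < l \<and> l < Suc n} = {(k, l). k < l \<and> l < n} \<union> (\<lambda>k. (k, n)) ` {..<n}"
    by (auto simp: less_Suc_eq)
  also have "(\<Sum>(k, l) \<in> \<dots>. d k + d l)
      = (real n - 1) * (\<Sum>i<n. d i) + (\<Sum>k<n. d k + d n)"
    unfolding Suc.IH[symmetric]
    by (subst sum.union_disjoint) (auto simp: fin sum.reindex inj_on_def)
  finally show ?case by (simp add: sum.distrib algebra_simps)
qed simp

lemma psd_complementary_diff: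
  assumes "\<forall>A\<in>set As. psd A" "l < length As" "l \<noteq> k"
  shows "psd (complementary As k - As ! l)"
proof -
  have "complementary As k - As ! l = (\<Sum>j\<in>{..<length As} - {k} - {l}. As ! j)"
    using assms(2,3) by (simp add: complementary_def sum_diff1)
  thus ?thesis using assms(1) by (auto intro!: psd_sum)
qed

text \<open>The complement of A_k dominates A_l, so the error of the pair is at most
  \<open>d k\<close>, by symmetry at most \<open>d l\<close>, hence at most their mean. Each index
  lies in r - 1 pairs, which cancels the normalization.\<close>

lemma pair_err_le_dich_err:
  fixes As :: "(complex^'n^'n) list"
  assumes "length As \<ge> 2" and psd: "\<forall>A\<in>set As. psd A"
  shows "pair_err As \<le> 1 / 2 * dich_err As"
proof -
  define d where "d i = opt_err [As ! i, complementary As i]" for i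
  let ?P = "{(k, l). k < l \<and> l < length As}"
  have le: "opt_err [As ! k, As ! l] \<le> d k" if "k < length As" "l < length As" "l \<noteq> k" for k l
    unfolding d_def using that psd by (intro opt_err_pair_mono psd_complementary_diff) auto
  have "opt_err [As ! k, As ! l] \<le> (d k + d l) / 2" if "k < l" "l < length As" for k l
    using le[of k l] le[of l k] opt_err_pair_commute_le[of "As ! k" "As ! l"] that psd by auto
  hence "(\<Sum>(k, l) \<in> ?P. opt_err [As ! k, As ! l]) \<le> (\<Sum>(k, l) \<in> ?P. (d k + d l) / 2)"
    by (intro sum_mono) auto
  also have "\<dots> = (real (length As) - 1) * (dich_err As / 2)"
    using sum_ordered_pairs_add[of d "length As"]
    by (simp add: dich_err_def d_def case_prod_unfold flip: sum_divide_distrib)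
  finally show ?thesis
    using assms(1) by (simp add: pair_err_def field_simps)
qed

section \<open>Dichotomic error against the optimal error, in both directions\<close>

lemma povm_sum:
  assumes "povm Es" "length Es = n"
  shows "psd (mat 1 - (\<Sum>i<n. Es ! i))"
  using assms by (simp add: povm_def loewner_le_def sum_list_sum_nth atLeast0LessThan)

text \<open>Serves to show that a single operator of a POVM lies below the identity.\<close>

lemma psd_diff_sum_mono:
  assumes "psd (M - (\<Sum>i\<in>I. f i))" "finite I" "J \<subseteq> I" "\<And>i. i \<in> I \<Longrightarrow> psd (f i)"
  shows "psd (M - (\<Sum>i\<in>J. f i))"
proof -
  have "psd (M - (\<Sum>i\<in>I. f i) + (\<Sum>i\<in>I - J. f i))"
    using assms by (intro psd_add psd_sum) auto
  thus ?thesis using assms by (simp add: sum_diff)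
qed

text \<open>Mistaking A_j for A_i is charged in two of the binary tests: as a miss in test j and as
  a false alarm in test i. This is the source of the factor 2.\<close>

lemma dich_err_le_opt_err:
  fixes As :: "(complex^'n^'n) list"
  assumes psd: "\<forall>A\<in>set As. psd A"
  shows "1 / 2 * dich_err As \<le> opt_err As"
proof -
  let ?n = "length As"
  obtain Es where Es: "length Es = ?n" "povm Es" "opt_err As = povm_err As Es"
    using opt_err_attained by blast
  \<comment> \<open>\<open>?t i j\<close> is the weight of answering i when A_j is true;
    \<open>?e i\<close> is the total weight of missing A_i.\<close>
  let ?t = "\<lambda>i j. Re (trace (As ! j ** Es ! i))"
  let ?e = "\<lambda>i. Re (trace (As ! i ** (mat 1 - Es ! i)))"
  have E: "psd (Es ! i)" if "i < ?n" for i
    using Es that by (simp add: povm_def)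
  have sub: "psd (mat 1 - (\<Sum>i\<in>J. Es ! i))" if "J \<subseteq> {..<?n}" for J
    by (rule psd_diff_sum_mono[OF povm_sum[OF Es(2,1)]]) (use that E in auto)
  have "opt_err [As ! i, complementary As i] \<le> ?e i + (\<Sum>j\<in>{..<?n} - {i}. ?t i j)"
    if "i < ?n" for i
    using opt_err_pair_le[OF E[OF that], of "As ! i" "complementary As i"] sub[of "{i}"] that
    by (simp add: complementary_def matrix_mult_sum_left trace_sum)
  hence "dich_err As \<le> (\<Sum>i<?n. ?e i + (\<Sum>j\<in>{..<?n} - {i}. ?t i j))"
    unfolding dich_err_def by (intro sum_mono) auto
  also have "\<dots> = (\<Sum>i<?n. ?e i) + (\<Sum>i<?n. \<Sum>j\<in>{..<?n} - {i}. ?t i j)"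
    by (rule sum.distrib)
  \<comment> \<open>The false alarms are regrouped by the true operator j instead of the answer
    i.\<close>
  also have "(\<Sum>i<?n. \<Sum>j\<in>{..<?n} - {i}. ?t i j) = (\<Sum>j<?n. \<Sum>i\<in>{..<?n} - {j}. ?t i j)"
  proof -
    have l: "{..<?n} - {i} = {j \<in> {..<?n}. i \<noteq> j}" and r: "{..<?n} - {i} = {j \<in> {..<?n}. j \<noteq> i}" for i
      by auto
    have "(\<Sum>i<?n. \<Sum>j\<in>{..<?n} - {i}. ?t i j) = (\<Sum>i<?n. \<Sum>j\<in>{j \<in> {..<?n}. i \<noteq> j}. ?t i j)"
      by (simp only: l)
    also have "\<dots> = (\<Sum>j<?n. \<Sum>i\<in>{i \<in> {..<?n}. i \<noteq> j}. ?t i j)"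
      by (rule sum.swap_restrict) auto
    finally show ?thesis by (simp only: r)
  qed
  \<comment> \<open>For fixed j the other E_i sum to at most I - E_j; equality can fail, as a POVM
    may sum to less than I.\<close>
  also have "\<dots> \<le> (\<Sum>j<?n. ?e j)"
  proof (rule sum_mono)
    fix j assume "j \<in> {..<?n}"
    hence j: "j < ?n" by simp
    have "0 \<le> Re (trace (As ! j ** (mat 1 - (\<Sum>i<?n. Es ! i))))"
      using psd_trace_mult_nonneg[OF _ povm_sum[OF Es(2,1)], of "As ! j"] psd j by simp
    also have "mat 1 - (\<Sum>i<?n. Es ! i) = mat 1 - Es ! j - (\<Sum>i\<in>{..<?n} - {j}. Es ! i)"
      using j by (simp add: sum_diff1)
    finally show "(\<Sum>i\<in>{..<?n} - {j}. ?t i j) \<le> ?e j"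
      by (simp add: matrix_sub_ldistrib[of _ "mat 1 - Es ! j"] matrix_mult_sum_right trace_sum trace_sub)
  qed
  finally show ?thesis
    using Es(3) by (simp add: povm_err_def)
qed

text \<open>The \<open>F i\<close> are chosen independently of each other, and the right-hand side
  adds up the errors of the tests (F_i, I - F_i). Inserting the optimal tests yields the dichotomic
  error.\<close>

lemma opt_err_le_effects:
  fixes As :: "(complex^'n^'n) list" and F :: "nat \<Rightarrow> complex^'n^'n"
  assumes psd: "\<forall>A\<in>set As. psd A"
    and F: "\<And>i. i < length As \<Longrightarrow> psd (F i)" "\<And>i. i < length As \<Longrightarrow> psd (mat 1 - F i)"
  shows "opt_err As \<le> (\<Sum>i<length As.
    Re (trace (As ! i ** (mat 1 - F i))) + Re (trace (complementary As i ** F i)))" (is "_ \<le> ?rhs")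
proof -
  let ?n = "length As"
  define S where "S = (\<Sum>i<?n. As ! i)"
  have S: "psd S" using psd by (auto simp: S_def intro!: psd_sum)
  \<comment> \<open>The shift by \<open>e\<close> makes \<open>T\<close> strictly positive even when
    \<open>S\<close> is singular; its cost vanishes with \<open>e\<close>.\<close>
  have bound: "opt_err As \<le> ?rhs + e * (\<Sum>i<?n. Re (trace (F i)))" if e: "e > 0" for e
  proof -
    define T where "T = S + mat (of_real e)"
    have T: "psd T" unfolding T_def using e by (intro psd_add S psd_mat_of_real) auto
    \<comment> \<open>The factor 2 is a normalization: I solves the equation with right-hand side 2
      T, and the A_i sum to T - e I.\<close>
    have "\<exists>E. T ** E + E ** T = As ! i + As ! i" for i
      by (rule lyapunov_solution[OF S e T_def])
    then obtain E where E: "\<And>i. T ** E i + E i ** T = As ! i + As ! i" by metis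
    have psdE: "psd (E i)" if "i < ?n" for i
      by (rule lyapunov_psd[OF S e T_def]) (unfold E, intro psd_add; use psd that in simp)
    \<comment> \<open>By linearity the defect I - sum E_i solves the equation with right-hand side 2
      e I, which is psd; hence so is the defect.\<close>
    have "T ** (mat 1 - (\<Sum>i<?n. E i)) + (mat 1 - (\<Sum>i<?n. E i)) ** T
        = T + T - (\<Sum>i<?n. T ** E i + E i ** T)"
      by (simp add: matrix_sub_ldistrib matrix_sub_rdistrib matrix_mult_sum_left
          matrix_mult_sum_right sum.distrib)
    also have "\<dots> = mat (of_real e) + mat (of_real e)"
    proof -
      have "(\<Sum>i<?n. T ** E i + E i ** T) = S + S"
        by (simp only: E sum.distrib S_def)
      thus ?thesis by (simp only: T_def) (simp add: algebra_simps)
    qed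
    finally have L: "T ** (mat 1 - (\<Sum>i<?n. E i)) + (mat 1 - (\<Sum>i<?n. E i)) ** T
        = mat (of_real e) + mat (of_real e)" .
    have "psd (mat 1 - (\<Sum>i<?n. E i))"
      by (rule lyapunov_psd[OF S e T_def], unfold L, intro psd_add psd_mat_of_real; use e in simp)
    hence povm: "povm (map E [0..<?n])"
      using psdE by (auto simp: povm_def loewner_le_def atLeast0LessThan interv_sum_list_conv_sum_set_nat)
    have "opt_err As \<le> povm_err As (map E [0..<?n])"
      by (rule opt_err_le[OF _ povm]) simp
    also have "\<dots> = (\<Sum>i<?n. Re (trace (As ! i ** (mat 1 - E i))))"
      by (simp add: povm_err_def)
    also have "\<dots> \<le> (\<Sum>i<?n. Re (trace (As ! i ** (mat 1 - F i)))
        + Re (trace (complementary As i ** F i)) + e * Re (trace (F i)))"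
    proof (rule sum_mono)
      fix i assume "i \<in> {..<?n}"
      hence i: "i < ?n" by simp
      have c: "complementary As i = S - As ! i"
        using i by (simp add: complementary_def S_def sum_diff1)
      \<comment> \<open>Since 2 A_i - T is A_i minus its complement minus e I, this is the trace
        bound subtracted from Tr A_i.\<close>
      show "Re (trace (As ! i ** (mat 1 - E i))) \<le> Re (trace (As ! i ** (mat 1 - F i)))
          + Re (trace (complementary As i ** F i)) + e * Re (trace (F i))"
        using lyapunov_trace_bound[OF T psdE[OF i] F[OF i] E]
        by (simp add: c T_def matrix_sub_ldistrib matrix_sub_rdistrib matrix_add_rdistrib
            trace_sub trace_add trace_mat_mult)
    qed
    also have "\<dots> = ?rhs + e * (\<Sum>i<?n. Re (trace (F i)))"
      by (simp add: sum.distrib sum_distrib_left)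
    finally show ?thesis .
  qed
  \<comment> \<open>The bound holds for every e > 0 and passes to the limit from the right at
    0.\<close>
  have "((\<lambda>e. ?rhs + e * (\<Sum>i<?n. Re (trace (F i)))) \<longlongrightarrow> ?rhs + 0 * (\<Sum>i<?n. Re (trace (F i))))
      (at_right 0)"
    by (intro tendsto_intros)
  moreover have "eventually (\<lambda>e. opt_err As \<le> ?rhs + e * (\<Sum>i<?n. Re (trace (F i)))) (at_right 0)"
    using bound by (auto simp: eventually_at_right_less intro: eventually_mono[OF eventually_at_right_less])
  ultimately have "opt_err As \<le> ?rhs + 0 * (\<Sum>i<?n. Re (trace (F i)))"
    by (intro tendsto_lowerbound) auto
  thus ?thesis by simp
qed

lemma opt_err_le_dich_err:
  fixes As :: "(complex^'n^'n) list"
  assumes psd: "\<forall>A\<in>set As. psd A"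
  shows "opt_err As \<le> dich_err As"
proof -
  \<comment> \<open>A test is chosen for every natural \<open>i\<close>; for \<open>i\<close> out of
    range the complement is the sum of all of \<open>As\<close>, still psd, and
    \<open>As ! i\<close> is just some fixed matrix.\<close>
  have "\<exists>F. psd F \<and> psd (mat 1 - F) \<and>
      Re (trace (As ! i ** (mat 1 - F))) + Re (trace (complementary As i ** F))
        = opt_err [As ! i, complementary As i]" for i
  proof -
    have "psd (complementary As i)"
      using psd unfolding complementary_def by (auto intro!: psd_sum)
    thus ?thesis using opt_err_pair_attained by metis
  qed
  then obtain F where F: "\<And>i. psd (F i)" "\<And>i. psd (mat 1 - F i)"
    "\<And>i. Re (trace (As ! i ** (mat 1 - F i))) + Re (trace (complementary As i ** F i))
      = opt_err [As ! i, complementary As i]"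
    by metis
  have "opt_err As \<le> (\<Sum>i<length As.
      Re (trace (As ! i ** (mat 1 - F i))) + Re (trace (complementary As i ** F i)))"
    by (rule opt_err_le_effects[OF psd F(1,2)])
  thus ?thesis by (simp add: F(3) dich_err_def)
qed

theorem theorem5p2:
  fixes As :: "(complex^'n^'n) list"
  assumes "length As \<ge> 2"
    and "\<forall>A\<in>set As. psd A"
  shows "pair_err As \<le> 1 / 2 * dich_err As
    \<and> 1 / 2 * dich_err As \<le> opt_err As
    \<and> opt_err As \<le> dich_err As"
  using pair_err_le_dich_err[OF assms] dich_err_le_opt_err[OF assms(2)]
    opt_err_le_dich_err[OF assms(2)] by blast

end
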